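(* Let $G$ be a finite simple cobipartite graph with clique partition $(V_1,V_2)$ such that the number of unsaturated vertices in $V_1$ is $k_1\ge1$ and the number in $V_2$ is $k_2\ge1$. Let $H$ be the graph obtained by deleting all of the unsaturated vertices in $G$. Then $Z(G)=Z(H)+(k_1-1)+(k_2-1)$.
   Context: A clique partition $(V_1,V_2)$ of $G$ is a partition of $V(G)$ into two cliques; $G$ is cobipartite if one exists. A vertex of $V_1$ (resp. $V_2$) is unsaturated with respect to $(V_1,V_2)$ if it has no neighbor in $V_2$ (resp. $V_1$). $Z(G)$ is the zero forcing number: the smallest size of an initially filled set from which repeatedly applying "a filled vertex whose only unfilled neighbor is $u$ forces $u$ to become filled" fills all vertices.
   Formalization: The formal theorem also assumes that H has a vertex or that k1 and k2 are both at least 2; otherwise the formula fails, e.g. for two isolated vertices, where Z(G)=2 but the right side is 0. Only failing cases are excluded. *)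

theory Defs
  imports "Graph_Theory.Graph_Theory"
begin

text \<open>
  Finite simple graphs are those of the locale \<^locale>\<open>graph\<close> from Graph_Theory: finite,
  symmetric, without loops or parallel arcs; each edge is a pair of opposite arcs, and
  \<open>u \<rightarrow>\<^bsub>G\<^esub> v\<close> is adjacency. That locale admits the graph without vertices.
\<close>

definition is_clique :: "('a, 'b) pre_digraph \<Rightarrow> 'a set \<Rightarrow> bool" where
  "is_clique G C \<longleftrightarrow> C \<subseteq> verts G \<and> (\<forall>u\<in>C. \<forall>v\<in>C. u \<noteq> v \<longrightarrow> u \<rightarrow>\<^bsub>G\<^esub> v)"

definition clique_partition :: "('a, 'b) pre_digraph \<Rightarrow> 'a set \<Rightarrow> 'a set \<Rightarrow> bool" where
  "clique_partition G V1 V2 \<longleftrightarrow>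
     V1 \<union> V2 = verts G \<and> V1 \<inter> V2 = {} \<and> is_clique G V1 \<and> is_clique G V2"

text \<open>
  For a clique partition \<open>(V1, V2)\<close>, the unsaturated vertices of \<open>V1\<close> are
  \<open>unsaturated G V1 V2\<close> and those of \<open>V2\<close> are \<open>unsaturated G V2 V1\<close>.
\<close>

definition unsaturated :: "('a, 'b) pre_digraph \<Rightarrow> 'a set \<Rightarrow> 'a set \<Rightarrow> 'a set" where
  "unsaturated G A B = {v \<in> A. \<not> (\<exists>w\<in>B. v \<rightarrow>\<^bsub>G\<^esub> w)}"

definition zf_step :: "('a, 'b) pre_digraph \<Rightarrow> 'a set \<Rightarrow> 'a set \<Rightarrow> bool" where
  "zf_step G F F' \<longleftrightarrow> (\<exists>v\<in>F. \<exists>u. {w. v \<rightarrow>\<^bsub>G\<^esub> w} - F = {u} \<and> F' = insert u F)"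

definition zero_forcing_set :: "('a, 'b) pre_digraph \<Rightarrow> 'a set \<Rightarrow> bool" where
  "zero_forcing_set G S \<longleftrightarrow> S \<subseteq> verts G \<and> (zf_step G)\<^sup>*\<^sup>* S (verts G)"

definition zero_forcing_number :: "('a, 'b) pre_digraph \<Rightarrow> nat" where
  "zero_forcing_number G = (LEAST n. \<exists>S. zero_forcing_set G S \<and> card S = n)"

end

theory Submission
  imports Defs
begin

text \<open>
  Lower bound: if the vertices of \<open>U\<close> all have the clique \<open>K\<close> as closed neighborhood, a zero
  forcing set omits at most one of them, since two omitted ones could never be forced; and the
  vertices of \<open>U\<close> force at most one vertex outside \<open>U\<close>, which happens only if \<open>U\<close> was filled
  from the start. Hence deleting \<open>U\<close> lowers the zero forcing number by at least \<open>card U - 1\<close>.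
  This is applied to both sets of unsaturated vertices.

  Upper bound: a minimum zero forcing set \<open>S\<close> of \<open>H\<close> can be chosen so that its first force goes
  across the partition, say \<open>v\<close> in \<open>V1\<close> forces \<open>u\<close> in \<open>V2\<close> (if instead \<open>v\<close> first forces \<open>x\<close> on
  its own side, exchange a neighbor of \<open>v\<close> on the other side for \<open>x\<close> in \<open>S\<close>); then \<open>S\<close> contains the saturated part
  of \<open>V1\<close>. In \<open>G\<close>, replace \<open>v\<close> by all unsaturated vertices of \<open>V1\<close> (one of which forces \<open>v\<close>) and
  add all but one of those of \<open>V2\<close>. From then on all forces inside \<open>H\<close> can be performed by
  vertices of \<open>V1\<close>, so the one missing unsaturated vertex of \<open>V2\<close> is no obstacle.
\<close>

section \<open>Closure of a vertex set under forcing\<close>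

text \<open>The final filled set does not depend on the order of forces, so it is taken as a least
  fixed point. Rule \<open>force\<close> does not ask \<open>u\<close> to be unfilled, which keeps
  the operator monotone.\<close>

inductive_set zf_closure :: "('a, 'b) pre_digraph \<Rightarrow> 'a set \<Rightarrow> 'a set" for G S where
  base: "v \<in> S \<Longrightarrow> v \<in> zf_closure G S"
| force: "v \<in> zf_closure G S \<Longrightarrow> v \<rightarrow>\<^bsub>G\<^esub> u
    \<Longrightarrow> (\<And>w. v \<rightarrow>\<^bsub>G\<^esub> w \<Longrightarrow> w \<noteq> u \<Longrightarrow> w \<in> zf_closure G S) \<Longrightarrow> u \<in> zf_closure G S"

lemma zf_closure_least:
  assumes "S \<subseteq> C"
    and "\<And>v u. v \<in> C \<Longrightarrow> v \<rightarrow>\<^bsub>G\<^esub> u \<Longrightarrow> (\<And>w. v \<rightarrow>\<^bsub>G\<^esub> w \<Longrightarrow> w \<noteq> u \<Longrightarrow> w \<in> C) \<Longrightarrow> u \<in> C"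
  shows "zf_closure G S \<subseteq> C"
proof
  fix x assume "x \<in> zf_closure G S"
  then show "x \<in> C"
    by induction (use assms in blast)+
qed

lemma zf_closure_subset: "S \<subseteq> zf_closure G S"
  by (auto intro: zf_closure.base)

lemma zf_closure_subset_closure:
  assumes "S \<subseteq> zf_closure G T" shows "zf_closure G S \<subseteq> zf_closure G T"
  by (rule zf_closure_least[OF assms]) (blast intro: zf_closure.force)

lemma zf_closure_mono: "S \<subseteq> T \<Longrightarrow> zf_closure G S \<subseteq> zf_closure G T"
  by (meson order_trans zf_closure_subset zf_closure_subset_closure)

text \<open>Each vertex filled by \<open>zf_step\<close> lies in the closure. Conversely, among the
  finitely many sets reachable from \<open>S\<close> a maximal one is stable under forcing, hence
  contains the closure.\<close>

lemma (in fin_digraph) zero_forcing_set_iff: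
  "zero_forcing_set G S \<longleftrightarrow> S \<subseteq> verts G \<and> verts G \<subseteq> zf_closure G S"
proof (intro iffI conjI; (elim conjE)?)
  assume "zero_forcing_set G S"
  then show "S \<subseteq> verts G" by (simp add: zero_forcing_set_def)
next
  assume "zero_forcing_set G S"
  then have "(zf_step G)\<^sup>*\<^sup>* S (verts G)" by (simp add: zero_forcing_set_def)
  then show "verts G \<subseteq> zf_closure G S"
  proof induction
    case base
    show ?case by (rule zf_closure_subset)
  next
    case (step F F')
    from step.hyps(2) obtain v u where "v \<in> F" and u: "{w. v \<rightarrow>\<^bsub>G\<^esub> w} - F = {u}"
      and F': "F' = insert u F"
      unfolding zf_step_def by blast
    have "u \<in> zf_closure G S"
      by (rule zf_closure.force[of v]) (use u \<open>v \<in> F\<close> step.IH in blast)+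
    then show ?case using step.IH F' by simp
  qed
next
  assume S: "S \<subseteq> verts G" and V: "verts G \<subseteq> zf_closure G S"
  let ?R = "{F. (zf_step G)\<^sup>*\<^sup>* S F}"
  have "F \<subseteq> verts G" if "(zf_step G)\<^sup>*\<^sup>* S F" for F
    using that
  proof induction
    case (step F F')
    from step.hyps(2) obtain v u where "v \<rightarrow>\<^bsub>G\<^esub> u" "F' = insert u F"
      unfolding zf_step_def by blast
    then show ?case using step.IH adj_in_verts(2) by auto
  qed (rule S)
  then have sub: "?R \<subseteq> Pow (verts G)" by blast
  then have "finite ?R" by (rule finite_subset) simp
  moreover have "S \<in> ?R" by simp
  ultimately have "\<exists>F\<in>?R. S \<subseteq> F \<and> (\<forall>F'\<in>?R. F \<subseteq> F' \<longrightarrow> F = F')" by (rule finite_has_maximal2)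
  then obtain F where F: "(zf_step G)\<^sup>*\<^sup>* S F" "S \<subseteq> F"
    and max: "\<forall>F'\<in>?R. F \<subseteq> F' \<longrightarrow> F = F'"
    by (elim bexE conjE) simp
  have "zf_closure G S \<subseteq> F"
  proof (rule zf_closure_least[OF F(2)], rule ccontr)
    fix v u assume "v \<in> F" "v \<rightarrow>\<^bsub>G\<^esub> u" "u \<notin> F" and w: "\<And>w. v \<rightarrow>\<^bsub>G\<^esub> w \<Longrightarrow> w \<noteq> u \<Longrightarrow> w \<in> F"
    then have "{w. v \<rightarrow>\<^bsub>G\<^esub> w} - F = {u}" by auto
    then have "zf_step G F (insert u F)" using \<open>v \<in> F\<close> unfolding zf_step_def by blast
    then have "insert u F \<in> ?R" using F(1) by simp
    then have "F = insert u F" using max by blast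
    then show False using \<open>u \<notin> F\<close> by blast
  qed
  then have "F = verts G" using V sub F(1) by blast
  then show "zero_forcing_set G S" using S F(1) by (simp add: zero_forcing_set_def)
qed

lemma zero_forcing_number_le: "zero_forcing_set G S \<Longrightarrow> zero_forcing_number G \<le> card S"
  unfolding zero_forcing_number_def by (rule Least_le) blast

text \<open>The whole vertex set is zero forcing, so \<open>LEAST\<close> ranges over a nonempty
  set.\<close>

lemma zero_forcing_number_attained:
  obtains S where "zero_forcing_set G S" "card S = zero_forcing_number G"
proof -
  have "zero_forcing_set G (verts G)" by (simp add: zero_forcing_set_def)
  then have "\<exists>n S. zero_forcing_set G S \<and> card S = n" by blast
  from LeastI_ex[OF this] show thesis using that unfolding zero_forcing_number_def by blast
qed

lemma dominates_induce_subgraph_iff: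
  "u \<rightarrow>\<^bsub>G \<restriction> X\<^esub> v \<longleftrightarrow> u \<in> X \<and> v \<in> X \<and> u \<rightarrow>\<^bsub>G\<^esub> v"
  unfolding arcs_ends_def arc_to_ends_def by (simp add: image_iff) metis

lemma (in graph) dominates_sym: "u \<rightarrow>\<^bsub>G\<^esub> v \<longleftrightarrow> v \<rightarrow>\<^bsub>G\<^esub> u"
  using sym_arcs symD[of "arcs_ends G"] unfolding symmetric_def by blast

lemma (in graph) graph_induce_subgraph:
  assumes "X \<subseteq> verts G" shows "graph (G \<restriction> X)"
proof -
  interpret H: wf_digraph "G \<restriction> X" by unfold_locales auto
  show ?thesis
  proof unfold_locales
    show "finite (verts (G \<restriction> X))" using finite_subset[OF assms finite_verts] by simp
    show "symmetric (G \<restriction> X)"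
      unfolding symmetric_def
      by (rule symI) (metis dominates_induce_subgraph_iff dominates_sym)
  qed (auto simp: no_loops no_multi_arcs arc_to_ends_def)
qed

section \<open>Lower bound by deleting twins\<close>

text \<open>For a minimum zero forcing set \<open>T\<close> of \<open>G\<close>, the set
  \<open>T - U\<close> works in the remaining graph up to one vertex. If \<open>U\<close> lies in
  \<open>T\<close>, a vertex forced by \<open>U\<close> may have to be added; otherwise
  \<open>T\<close> misses just one vertex of \<open>U\<close> and nothing is added. Both ways at
  least \<open>card U - 1\<close> is saved.\<close>

lemma (in graph) zero_forcing_number_delete_twins:
  assumes UK: "U \<subseteq> K" and U: "U \<noteq> {}" and K: "is_clique G K"
    and nb: "\<And>u w. u \<in> U \<Longrightarrow> u \<rightarrow>\<^bsub>G\<^esub> w \<longleftrightarrow> w \<in> K - {u}"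
  shows "zero_forcing_number (G \<restriction> (verts G - U)) + (card U - 1) \<le> zero_forcing_number G"
proof -
  define H where "H = G \<restriction> (verts G - U)"
  interpret H: graph H unfolding H_def by (rule graph_induce_subgraph) simp
  have dom: "a \<rightarrow>\<^bsub>H\<^esub> b \<longleftrightarrow> a \<notin> U \<and> b \<notin> U \<and> a \<rightarrow>\<^bsub>G\<^esub> b" for a b
    using adj_in_verts unfolding H_def dominates_induce_subgraph_iff by auto
  have vH: "verts H = verts G - U" by (simp add: H_def)
  have KV: "K \<subseteq> verts G" using K by (simp add: is_clique_def)
  have finU: "finite U" by (rule finite_subset[OF order_trans[OF UK KV] finite_verts])
  obtain T where zT: "zero_forcing_set G T" and cT: "card T = zero_forcing_number G"
    by (rule zero_forcing_number_attained)
  then have TV: "T \<subseteq> verts G" and T: "verts G \<subseteq> zf_closure G T"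
    by (simp_all add: zero_forcing_set_iff)
  have finT: "finite T" by (rule finite_subset[OF TV finite_verts])
  have card_T: "card T = card (T - U) + card (T \<inter> U)"
    using finT by (metis add.commute card_Int_Diff)
  \<comment> \<open>As \<open>T\<close> is zero forcing, a set that contains \<open>T\<close> and
    that no force leaves is everything. Each use below applies this to a candidate set.\<close>
  have full: "verts G \<subseteq> C"
    if "T \<subseteq> C" and "\<And>v u. v \<in> C \<Longrightarrow> v \<rightarrow>\<^bsub>G\<^esub> u \<Longrightarrow> u \<notin> C
      \<Longrightarrow> (\<And>w. v \<rightarrow>\<^bsub>G\<^esub> w \<Longrightarrow> w \<noteq> u \<Longrightarrow> w \<in> C) \<Longrightarrow> False" for C
    using T zf_closure_least[of T C G] that by blast
  \<comment> \<open>A force of \<open>G\<close> between vertices outside \<open>U\<close> carries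
    over to \<open>H\<close> when \<open>U\<close> is regarded as filled.\<close>
  have hforce: "u \<in> zf_closure H S"
    if "v \<in> zf_closure H S" "v \<notin> U" "u \<notin> U" "v \<rightarrow>\<^bsub>G\<^esub> u"
      "\<And>w. v \<rightarrow>\<^bsub>G\<^esub> w \<Longrightarrow> w \<noteq> u \<Longrightarrow> w \<in> zf_closure H S \<union> U" for S v u
    using that by (intro zf_closure.force[of v H S u]) (auto simp: dom)
  have clU: "zf_closure H S \<inter> U = {}" if "S \<inter> U = {}" for S
  proof -
    have "zf_closure H S \<subseteq> - U" by (rule zf_closure_least) (use that dom in auto)
    then show ?thesis by blast
  qed
  have "\<exists>S. zero_forcing_set H S \<and> card S + (card U - 1) \<le> card T"
  proof (cases "U \<subseteq> T")
    case True
    then have cT: "card T = card (T - U) + card U" using card_T by (simp add: Int_absorb1)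
    have cU: "card U \<ge> 1" using U finU by (simp add: Suc_le_eq card_gt_0_iff)
    let ?C = "zf_closure H (T - U)"
    show ?thesis
    proof (cases "verts H \<subseteq> ?C")
      case True
      then have "zero_forcing_set H (T - U)" using TV by (auto simp: H.zero_forcing_set_iff vH)
      then show ?thesis using cT by (intro exI[of _ "T - U"]) auto
    next
      case False
      then have "\<not> verts G \<subseteq> ?C \<union> U" by (auto simp: vH)
      moreover have "T \<subseteq> ?C \<union> U" using zf_closure_subset[of "T - U" H] by blast
      ultimately obtain v y where vy: "v \<in> ?C \<union> U" "v \<rightarrow>\<^bsub>G\<^esub> y" "y \<notin> ?C \<union> U"
        "\<And>w. v \<rightarrow>\<^bsub>G\<^esub> w \<Longrightarrow> w \<noteq> y \<Longrightarrow> w \<in> ?C \<union> U"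
        using full by meson
      have "v \<in> U"
      proof (rule ccontr)
        assume "v \<notin> U"
        then have "y \<in> ?C" by (intro hforce[of v _ y]) (use vy in auto)
        then show False using vy by blast
      qed
      \<comment> \<open>The closed neighborhood of \<open>v\<close> is \<open>K\<close>, so
        \<open>y\<close> is the only vertex of \<open>K\<close> still missing. Once \<open>y\<close>
        is added, \<open>U\<close> has nothing left to force.\<close>
      then have KC: "K \<subseteq> ?C \<union> U \<union> {y}" and yK: "y \<in> K" using vy nb by auto
      let ?S = "insert y (T - U)"
      let ?C' = "zf_closure H ?S"
      have CC': "insert y ?C \<subseteq> ?C'"
        using zf_closure_mono[of "T - U" ?S H] zf_closure_subset[of ?S H] by blast
      have "verts G \<subseteq> ?C' \<union> U"
      proof (rule full)
        show "T \<subseteq> ?C' \<union> U" using zf_closure_subset[of ?S H] by blast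
        fix a b assume ab: "a \<in> ?C' \<union> U" "a \<rightarrow>\<^bsub>G\<^esub> b" "b \<notin> ?C' \<union> U"
          "\<And>w. a \<rightarrow>\<^bsub>G\<^esub> w \<Longrightarrow> w \<noteq> b \<Longrightarrow> w \<in> ?C' \<union> U"
        show False
        proof (cases "a \<in> U")
          case True
          then show False using ab nb KC CC' by auto
        next
          case False
          then have "b \<in> ?C'" by (intro hforce[of a _ b]) (use ab in auto)
          then show False using ab by blast
        qed
      qed
      then have "zero_forcing_set H ?S" using TV yK KV vy by (auto simp: H.zero_forcing_set_iff vH)
      moreover have "card ?S \<le> card (T - U) + 1"
        using finT by (simp add: card_insert_if)
      ultimately show ?thesis using cT cU by (intro exI[of _ ?S]) auto
    qed
  next
    case False
    then obtain u0 where u0: "u0 \<in> U" "u0 \<notin> T" by blast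
    \<comment> \<open>Two unfilled twins block each other: any other vertex adjacent to one is
      adjacent to both, so it can force neither.\<close>
    have "U - {u0} \<subseteq> T"
    proof (rule ccontr)
      assume "\<not> U - {u0} \<subseteq> T"
      then obtain x where x: "x \<in> U" "x \<noteq> u0" "x \<notin> T" by blast
      have "verts G \<subseteq> verts G - {x, u0}"
      proof (rule full)
        show "T \<subseteq> verts G - {x, u0}" using TV x u0 by blast
        fix v u assume v: "v \<in> verts G - {x, u0}" "v \<rightarrow>\<^bsub>G\<^esub> u" "u \<notin> verts G - {x, u0}"
          "\<And>w. v \<rightarrow>\<^bsub>G\<^esub> w \<Longrightarrow> w \<noteq> u \<Longrightarrow> w \<in> verts G - {x, u0}"
        then have "u = x \<or> u = u0" using adj_in_verts(2) by blast
        then have "v \<in> K" using v nb x u0 dominates_sym by blast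
        then have "v \<rightarrow>\<^bsub>G\<^esub> x" "v \<rightarrow>\<^bsub>G\<^esub> u0" using nb x u0 dominates_sym v by blast+
        then show False using v(4) x(2) by blast
      qed
      then show False using x UK KV by blast
    qed
    then have "T \<inter> U = U - {u0}" using u0 by blast
    then have cT: "card T = card (T - U) + (card U - 1)" using card_T u0 finU by simp
    let ?C = "zf_closure H (T - U)"
    have CU: "?C \<inter> U = {}" by (rule clU) blast
    \<comment> \<open>While \<open>u0\<close> is unfilled it is an unfilled neighbor of every other
      vertex of \<open>U\<close>, so these can force nothing outside \<open>U\<close>. A vertex
      forcing \<open>u0\<close> lies in \<open>K\<close>, so \<open>K - U\<close> is filled by then
      and \<open>U\<close> again has nothing to force.\<close>
    define D where "D = ?C \<union> (if K - U \<subseteq> ?C then U else U - {u0})"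
    have DC: "D - U \<subseteq> ?C" "D \<subseteq> ?C \<union> U" "?C \<subseteq> D" by (auto simp: D_def)
    have "verts G \<subseteq> D"
    proof (rule full)
      show "T \<subseteq> D" using zf_closure_subset[of "T - U" H] u0 unfolding D_def by auto
      fix v u assume v: "v \<in> D" "v \<rightarrow>\<^bsub>G\<^esub> u" "u \<notin> D" "\<And>w. v \<rightarrow>\<^bsub>G\<^esub> w \<Longrightarrow> w \<noteq> u \<Longrightarrow> w \<in> D"
      show False
      proof (cases "u \<in> U")
        case True
        then have u: "u = u0" "\<not> K - U \<subseteq> ?C" using v(3) unfolding D_def by (auto split: if_splits)
        have "v \<in> K" using True nb v(2) dominates_sym by blast
        have "w \<in> ?C" if "w \<in> K - U" for w
        proof (cases "w = v")
          case False
          then have "v \<rightarrow>\<^bsub>G\<^esub> w" using K \<open>v \<in> K\<close> that by (auto simp: is_clique_def)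
          then show ?thesis using v(4) that True DC by blast
        qed (use v(1) that DC in blast)
        then show False using u by blast
      next
        case uU: False
        show False
        proof (cases "v \<in> U")
          case True
          then have uK: "u \<in> K" using nb v by blast
          then have "\<not> K - U \<subseteq> ?C" using uU v(3) DC by blast
          then have "u0 \<notin> D" using u0 CU by (auto simp: D_def)
          moreover have "v \<rightarrow>\<^bsub>G\<^esub> u0" using True calculation v(1) nb u0 UK by blast
          ultimately show False using v(4) uU u0 by blast
        next
          case False
          then have "u \<in> ?C"
            by (intro hforce[of v _ u]) (use v uU DC in blast)+
          then show False using v(3) DC by blast
        qed
      qed
    qed
    then have "zero_forcing_set H (T - U)" using TV DC by (auto simp: H.zero_forcing_set_iff vH)
    then show ?thesis using cT by (intro exI[of _ "T - U"]) auto
  qed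
  then show ?thesis using zero_forcing_number_le[of H] cT unfolding H_def by fastforce
qed

section \<open>Upper bound by extending a zero forcing set of the saturated part\<close>

lemma clique_partition_commute: "clique_partition G A B \<longleftrightarrow> clique_partition G B A"
  by (auto simp: clique_partition_def)

text \<open>A first force that stays on one side can be traded for a crossing one, because its
  origin is saturated. Both orientations of the partition occur, as the first force may start on
  either side.\<close>

lemma (in graph) saturated_crossing_force:
  assumes AB: "clique_partition G A B" and "unsaturated G A B = {}" "unsaturated G B A = {}"
    and ne: "verts G \<noteq> {}"
  obtains A' B' S v u where "A' = A \<and> B' = B \<or> A' = B \<and> B' = A"
    and "zero_forcing_set G S" "card S = zero_forcing_number G"
    and "A' \<subseteq> S" "v \<in> A'" "u \<in> B'" "v \<rightarrow>\<^bsub>G\<^esub> u" "u \<notin> S" "\<And>w. v \<rightarrow>\<^bsub>G\<^esub> w \<Longrightarrow> w \<noteq> u \<Longrightarrow> w \<in> S"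
proof -
  obtain S where zS: "zero_forcing_set G S" and cS: "card S = zero_forcing_number G"
    by (rule zero_forcing_number_attained)
  then have SV: "S \<subseteq> verts G" and S: "verts G \<subseteq> zf_closure G S"
    by (simp_all add: zero_forcing_set_iff)
  have finS: "finite S" by (rule finite_subset[OF SV finite_verts])
  have V: "A \<union> B = verts G" "A \<inter> B = {}" and cl: "is_clique G A" "is_clique G B"
    using AB by (auto simp: clique_partition_def)
  have sat: "\<exists>w\<in>B. a \<rightarrow>\<^bsub>G\<^esub> w" if "a \<in> A" for a
    using that assms(2) by (auto simp: unsaturated_def)
  have sat': "\<exists>w\<in>A. a \<rightarrow>\<^bsub>G\<^esub> w" if "a \<in> B" for a
    using that assms(3) by (auto simp: unsaturated_def)
  \<comment> \<open>This guarantees a first force. Saturation gives a crossing edge from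
    \<open>a\<close> to \<open>b\<close>, and all vertices but \<open>b\<close> already force
    \<open>b\<close>, so the full vertex set is not minimum.\<close>
  have "S \<noteq> verts G"
  proof
    assume SG: "S = verts G"
    obtain a b where ab: "a \<in> A" "b \<in> B" "a \<rightarrow>\<^bsub>G\<^esub> b"
      using ne V sat sat' by (metis UnE ex_in_conv dominates_sym)
    let ?S = "S - {b}"
    have S': "?S \<subseteq> zf_closure G ?S" by (rule zf_closure_subset)
    have "b \<in> zf_closure G ?S"
    proof (rule zf_closure.force[OF _ ab(3)])
      show "a \<in> zf_closure G ?S" using ab V SG S' by blast
      show "w \<in> zf_closure G ?S" if "a \<rightarrow>\<^bsub>G\<^esub> w" "w \<noteq> b" for w
        using that adj_in_verts(2)[of a w] SG S' by blast
    qed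
    then have "zero_forcing_set G ?S" using S' SG by (auto simp: zero_forcing_set_iff)
    then have "card S \<le> card ?S" using cS zero_forcing_number_le by metis
    moreover have "card ?S < card S" using ab V SG finS by (intro card_Diff1_less) auto
    ultimately show False by simp
  qed
  then have "\<not> zf_closure G S \<subseteq> S" using SV S by blast
  then obtain v u where vu: "v \<in> S" "v \<rightarrow>\<^bsub>G\<^esub> u" "u \<notin> S" "\<And>w. v \<rightarrow>\<^bsub>G\<^esub> w \<Longrightarrow> w \<noteq> u \<Longrightarrow> w \<in> S"
    using zf_closure_least[of S S G] by blast
  have main: "\<exists>S v u. zero_forcing_set G S \<and> card S = zero_forcing_number G \<and> A' \<subseteq> S \<and> v \<in> A' \<and> u \<in> B'
      \<and> v \<rightarrow>\<^bsub>G\<^esub> u \<and> u \<notin> S \<and> (\<forall>w. v \<rightarrow>\<^bsub>G\<^esub> w \<longrightarrow> w \<noteq> u \<longrightarrow> w \<in> S)"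
    if vA: "v \<in> A'" and V': "A' \<union> B' = verts G" "A' \<inter> B' = {}" and cl': "is_clique G A'"
      and sat: "\<exists>w\<in>B'. v \<rightarrow>\<^bsub>G\<^esub> w" for A' B'
  proof -
    \<comment> \<open>All of the clique \<open>A'\<close> other than \<open>v\<close> is adjacent to
      \<open>v\<close>, so only \<open>u\<close> can be unfilled there.\<close>
    have AS: "A' - {u} \<subseteq> S"
    proof
      fix w assume w: "w \<in> A' - {u}"
      show "w \<in> S"
      proof (cases "w = v")
        case False
        then have "v \<rightarrow>\<^bsub>G\<^esub> w" using cl' vA w by (auto simp: is_clique_def)
        then show ?thesis using vu w by blast
      qed (use vu in simp)
    qed
    show ?thesis
    proof (cases "u \<in> B'")
      case True
      then have "A' \<subseteq> S" using AS V' by blast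
      then show ?thesis using zS cS vu vA True
        by (intro exI[of _ S] exI[of _ v] exI[of _ u]) auto
    next
      case False
      then have uA: "u \<in> A'" using V' vu(2) adj_in_verts(2) by blast
      obtain a where a: "a \<in> B'" "v \<rightarrow>\<^bsub>G\<^esub> a" using sat by blast
      then have aS: "a \<in> S" and au: "a \<noteq> u" using vu(4) False by auto
      \<comment> \<open>The exchange: \<open>a\<close> becomes the only unfilled neighbor of
        \<open>v\<close>, so \<open>v\<close> forces it back and all of \<open>S\<close> is
        recovered at equal size.\<close>
      let ?S = "insert u (S - {a})"
      have S': "?S \<subseteq> zf_closure G ?S" by (rule zf_closure_subset)
      have nbS: "w \<in> ?S" if "v \<rightarrow>\<^bsub>G\<^esub> w" "w \<noteq> a" for w using that vu(4) by blast
      have vS: "v \<in> ?S" using vu(1) a vA V' by blast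
      have "a \<in> zf_closure G ?S"
        by (rule zf_closure.force[of v]) (use vS nbS a S' in blast)+
      then have "S \<subseteq> zf_closure G ?S" using S' by blast
      then have "verts G \<subseteq> zf_closure G ?S" using S zf_closure_subset_closure by blast
      then have "zero_forcing_set G ?S"
        using SV uA V' by (auto simp: zero_forcing_set_iff)
      moreover have "card ?S = zero_forcing_number G"
        using cS finS vu(3) aS card_Suc_Diff1[of S a] by simp
      moreover have "A' \<subseteq> ?S" using AS a V' by blast
      moreover have "a \<notin> ?S" using au by blast
      ultimately show ?thesis using vA a nbS
        by (intro exI[of _ ?S] exI[of _ v] exI[of _ a]) auto
    qed
  qed
  have "v \<in> A \<or> v \<in> B" using vu(1) SV V by blast
  then show thesis
  proof
    assume v: "v \<in> A"
    from main[OF this V cl(1) sat[OF v]] show thesis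
      by (elim exE conjE) (rule that[of A B], auto)
  next
    assume v: "v \<in> B"
    have "B \<union> A = verts G" "B \<inter> A = {}" using V by auto
    from main[OF v this cl(2) sat'[OF v]] show thesis
      by (elim exE conjE) (rule that[of B A], auto)
  qed
qed

text \<open>Once \<open>A\<close> is full, its vertices can perform every force into
  \<open>B - U2\<close>, and none of them sees the unfilled vertex \<open>u2\<close> of
  \<open>U2\<close>. That vertex is filled last.\<close>

lemma (in graph) zero_forcing_number_le_of_crossing_force:
  assumes AB: "clique_partition G A B"
    and U: "U1 = unsaturated G A B" "U2 = unsaturated G B A" "U1 \<noteq> {}" "U2 \<noteq> {}"
    and H: "H = G \<restriction> (verts G - (U1 \<union> U2))" and zS: "zero_forcing_set H S"
    and S: "A - U1 \<subseteq> S" "v \<in> A - U1" "u \<in> B - U2" "v \<rightarrow>\<^bsub>H\<^esub> u" "u \<notin> S"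
      "\<And>w. v \<rightarrow>\<^bsub>H\<^esub> w \<Longrightarrow> w \<noteq> u \<Longrightarrow> w \<in> S"
  shows "zero_forcing_number G \<le> card S + (card U1 - 1) + (card U2 - 1)"
proof -
  interpret H: graph H unfolding H by (rule graph_induce_subgraph) simp
  have V: "A \<union> B = verts G" "A \<inter> B = {}" and cl: "is_clique G A" "is_clique G B"
    using AB by (auto simp: clique_partition_def)
  have adjA: "a \<rightarrow>\<^bsub>G\<^esub> b" if "a \<in> A" "b \<in> A" "a \<noteq> b" for a b
    using cl that by (auto simp: is_clique_def)
  have adjB: "a \<rightarrow>\<^bsub>G\<^esub> b" if "a \<in> B" "b \<in> B" "a \<noteq> b" for a b
    using cl that by (auto simp: is_clique_def)
  have UA: "U1 \<subseteq> A" and UB: "U2 \<subseteq> B" by (auto simp: U unsaturated_def)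
  have nU1: "\<not> a \<rightarrow>\<^bsub>G\<^esub> b" "\<not> b \<rightarrow>\<^bsub>G\<^esub> a" if "a \<in> U1" "b \<in> B" for a b
    using that dominates_sym[of a b] by (auto simp: U unsaturated_def)
  have nU2: "\<not> a \<rightarrow>\<^bsub>G\<^esub> b" "\<not> b \<rightarrow>\<^bsub>G\<^esub> a" if "a \<in> U2" "b \<in> A" for a b
    using that dominates_sym[of a b] by (auto simp: U unsaturated_def)
  have dom: "a \<rightarrow>\<^bsub>H\<^esub> b \<longleftrightarrow> a \<notin> U1 \<union> U2 \<and> b \<notin> U1 \<union> U2 \<and> a \<rightarrow>\<^bsub>G\<^esub> b" for a b
    using adj_in_verts unfolding H dominates_induce_subgraph_iff by auto
  have vH: "verts H = verts G - (U1 \<union> U2)" by (simp add: H)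
  have SH: "S \<subseteq> verts H" and clS: "verts H \<subseteq> zf_closure H S"
    using zS by (simp_all add: H.zero_forcing_set_iff)
  have "S \<subseteq> verts G" "U1 \<subseteq> verts G" "U2 \<subseteq> verts G" using SH UA UB V vH by auto
  then have fin: "finite S" "finite U1" "finite U2" by (auto intro: finite_subset)
  obtain u1 u2 where u1: "u1 \<in> U1" and u2: "u2 \<in> U2" using U by blast
  define T where "T = (S - {v}) \<union> U1 \<union> (U2 - {u2})"
  let ?C = "zf_closure G T"
  have TC: "T \<subseteq> ?C" by (rule zf_closure_subset)
  have vS: "v \<in> S" using S by blast
  \<comment> \<open>All neighbors of \<open>u1\<close> lie in \<open>A\<close>, where only
    \<open>v\<close> is unfilled; this pays for removing \<open>v\<close> from
    \<open>S\<close>.\<close>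
  have "v \<in> ?C"
  proof (rule zf_closure.force[of u1])
    show "u1 \<in> ?C" using u1 TC by (auto simp: T_def)
    show "u1 \<rightarrow>\<^bsub>G\<^esub> v" using adjA u1 UA S by blast
    fix w assume w: "u1 \<rightarrow>\<^bsub>G\<^esub> w" "w \<noteq> v"
    then have "w \<in> A" using nU1 u1 V adj_in_verts(2) by blast
    then show "w \<in> ?C" using w S(1) TC by (auto simp: T_def)
  qed
  then have C: "S \<union> U1 \<union> (U2 - {u2}) \<subseteq> ?C" using TC by (auto simp: T_def)
  then have AC: "A \<subseteq> ?C" using S(1) by blast
  have "zf_closure H S \<subseteq> ?C"
  proof (rule zf_closure_least)
    show "S \<subseteq> ?C" using C by blast
    fix a b assume ab: "a \<in> ?C" "a \<rightarrow>\<^bsub>H\<^esub> b" "\<And>w. a \<rightarrow>\<^bsub>H\<^esub> w \<Longrightarrow> w \<noteq> b \<Longrightarrow> w \<in> ?C"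
    \<comment> \<open>\<open>A\<close> is full and has no neighbor in \<open>U2\<close>, so only the
      neighbors in \<open>B - U2\<close> can hinder a force from \<open>A\<close>.\<close>
    have by_A: "b \<in> ?C" if "c \<in> A" "c \<rightarrow>\<^bsub>G\<^esub> b" "\<And>w. c \<rightarrow>\<^bsub>G\<^esub> w \<Longrightarrow> w \<in> B - U2 \<Longrightarrow> w \<noteq> b \<Longrightarrow> w \<in> ?C" for c
    proof (rule zf_closure.force[of c])
      show "c \<in> ?C" using that AC by blast
      show "c \<rightarrow>\<^bsub>G\<^esub> b" by fact
      fix w assume w: "c \<rightarrow>\<^bsub>G\<^esub> w" "w \<noteq> b"
      then have "w \<in> A \<or> w \<in> B" using V adj_in_verts(2) by blast
      moreover have "w \<notin> U2" using nU2 that(1) w by blast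
      ultimately show "w \<in> ?C" using AC that(3) w by blast
    qed
    show "b \<in> ?C"
    proof (cases "b \<in> A")
      case False
      then have b: "b \<in> B" using ab(2) V dom adj_in_verts(2) by blast
      show ?thesis
      proof (cases "a \<in> A")
        case True
        show ?thesis
        proof (rule by_A[OF True])
          show "a \<rightarrow>\<^bsub>G\<^esub> b" using ab(2) dom by blast
          fix w assume "a \<rightarrow>\<^bsub>G\<^esub> w" "w \<in> B - U2" "w \<noteq> b"
          then show "w \<in> ?C" using ab(2,3) dom UA V by blast
        qed
      next
        case False
        then have a: "a \<in> B" using ab(2) V dom adj_in_verts(1) by blast
        have "b \<notin> U2" using ab(2) dom by blast
        \<comment> \<open>If \<open>a\<close> in \<open>B\<close> forces \<open>b\<close>, then all
          of \<open>B - U2\<close> except \<open>b\<close> is filled. Hence a neighbor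
          \<open>c\<close> of the saturated vertex \<open>b\<close> in \<open>A\<close> can force
          \<open>b\<close> instead, even if \<open>u2\<close> blocks \<open>a\<close>.\<close>
        then obtain c where c: "c \<in> A" "b \<rightarrow>\<^bsub>G\<^esub> c" using b by (auto simp: U unsaturated_def)
        show ?thesis
        proof (rule by_A[OF c(1)])
          show "c \<rightarrow>\<^bsub>G\<^esub> b" using c dominates_sym by blast
          fix w assume w: "w \<in> B - U2" "w \<noteq> b"
          show "w \<in> ?C"
          proof (cases "w = a")
            case False
            then have "a \<rightarrow>\<^bsub>H\<^esub> w" using ab(2) dom adjB a w UA V by blast
            then show ?thesis using ab(3) w by blast
          qed (use ab in simp)
        qed
      qed
    qed (use AC in blast)
  qed
  then have HC: "verts H \<subseteq> ?C" using clS by blast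
  \<comment> \<open>Everything but \<open>u2\<close> is now filled, and \<open>u\<close> is adjacent
    to it within the clique \<open>B\<close>.\<close>
  have "u2 \<in> ?C"
  proof (rule zf_closure.force[of u])
    show "u \<in> ?C" using HC S(3) V UA vH by blast
    show "u \<rightarrow>\<^bsub>G\<^esub> u2" using S(3) u2 UB adjB by blast
    fix w assume "u \<rightarrow>\<^bsub>G\<^esub> w" "w \<noteq> u2"
    then show "w \<in> ?C" using HC C vH adj_in_verts(2) by blast
  qed
  then have "verts G \<subseteq> ?C" using HC C vH by blast
  moreover have "T \<subseteq> verts G" using SH vH UA UB V by (auto simp: T_def)
  ultimately have "zero_forcing_set G T" by (simp add: zero_forcing_set_iff)
  then have "zero_forcing_number G \<le> card T" by (rule zero_forcing_number_le)
  also have "card T \<le> card (S - {v}) + card U1 + card (U2 - {u2})"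
    unfolding T_def by (meson add_le_mono1 card_Un_le order_trans)
  also have "\<dots> = (card S - 1) + card U1 + (card U2 - 1)" using fin vS u2 by simp
  \<comment> \<open>The unit saved by removing \<open>v\<close> is moved from \<open>S\<close> to
    \<open>U1\<close>; truncated subtraction requires both to be nonempty.\<close>
  also have "\<dots> = card S + (card U1 - 1) + (card U2 - 1)"
  proof -
    have "card S \<ge> 1" "card U1 \<ge> 1"
      using fin vS u1 by (auto simp: Suc_le_eq card_gt_0_iff)
    then show ?thesis by simp
  qed
  finally show ?thesis .
qed

section \<open>The two bounds combined\<close>

text \<open>The last assumption excludes an empty \<open>H\<close> with \<open>k1 = 1\<close> or
  \<open>k2 = 1\<close>. There \<open>G\<close> is a disjoint union of two cliques, one of them an
  isolated vertex. That vertex must be filled initially, so the formula, with value 0 for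
  \<open>H\<close>, is too small.\<close>

theorem theorem5p11:
  fixes G H :: "('a, 'b) pre_digraph" and V1 V2 :: "'a set" and k1 k2 :: nat
  assumes "graph G"
    and "clique_partition G V1 V2"
    and "card (unsaturated G V1 V2) = k1" and "k1 \<ge> 1"
    and "card (unsaturated G V2 V1) = k2" and "k2 \<ge> 1"
    and "H = G \<restriction> (verts G - (unsaturated G V1 V2 \<union> unsaturated G V2 V1))"
    and "verts H \<noteq> {} \<or> (k1 \<ge> 2 \<and> k2 \<ge> 2)"
  shows "zero_forcing_number G = zero_forcing_number H + (k1 - 1) + (k2 - 1)"
proof (rule antisym)
  interpret graph G by fact
  define U1 where "U1 = unsaturated G V1 V2"
  define U2 where "U2 = unsaturated G V2 V1"
  have H: "H = G \<restriction> (verts G - (U1 \<union> U2))" using assms(7) by (simp add: U1_def U2_def)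
  interpret H: graph H unfolding H by (rule graph_induce_subgraph) simp
  have vH: "verts H = verts G - (U1 \<union> U2)" by (simp add: H)
  have ne: "U1 \<noteq> {}" "U2 \<noteq> {}" using assms(3-6) by (auto simp: U1_def U2_def)
  have V: "V1 \<union> V2 = verts G" "V1 \<inter> V2 = {}" and cl: "is_clique G V1" "is_clique G V2"
    using assms(2) by (auto simp: clique_partition_def)
  have sub: "U1 \<subseteq> V1" "U2 \<subseteq> V2" by (auto simp: U1_def U2_def unsaturated_def)
  \<comment> \<open>Unsaturated vertices of one side are twins whose closed neighborhood is that
    side, as the deletion lemma requires.\<close>
  have nb1: "u \<rightarrow>\<^bsub>G\<^esub> w \<longleftrightarrow> w \<in> V1 - {u}" if "u \<in> U1" for u w
    using that cl(1) V adj_in_verts(2)[of u w] adj_not_same[of u]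
    by (auto simp: U1_def unsaturated_def is_clique_def)
  have nb2: "u \<rightarrow>\<^bsub>G\<^esub> w \<longleftrightarrow> w \<in> V2 - {u}" if "u \<in> U2" for u w
    using that cl(2) V adj_in_verts(2)[of u w] adj_not_same[of u]
    by (auto simp: U2_def unsaturated_def is_clique_def)
  have dom: "a \<rightarrow>\<^bsub>H\<^esub> b \<longleftrightarrow> a \<notin> U1 \<union> U2 \<and> b \<notin> U1 \<union> U2 \<and> a \<rightarrow>\<^bsub>G\<^esub> b" for a b
    using adj_in_verts unfolding H dominates_induce_subgraph_iff by auto

  show "zero_forcing_number H + (k1 - 1) + (k2 - 1) \<le> zero_forcing_number G"
  proof -
    \<comment> \<open>The two sets are deleted one after the other. Removing \<open>U1\<close>
      leaves the clique \<open>V2\<close> and the neighborhoods of \<open>U2\<close> unchanged, so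
      the twin condition persists in \<open>G1\<close>.\<close>
    define G1 where "G1 = G \<restriction> (verts G - U1)"
    interpret G1: graph G1 unfolding G1_def by (rule graph_induce_subgraph) simp
    have dom1: "a \<rightarrow>\<^bsub>G1\<^esub> b \<longleftrightarrow> a \<notin> U1 \<and> b \<notin> U1 \<and> a \<rightarrow>\<^bsub>G\<^esub> b" for a b
      using adj_in_verts unfolding G1_def dominates_induce_subgraph_iff by auto
    have dis: "V2 \<inter> U1 = {}" using sub V by blast
    have "is_clique G1 V2"
      using cl(2) dis unfolding is_clique_def dom1 by (auto simp: G1_def)
    moreover have "u \<rightarrow>\<^bsub>G1\<^esub> w \<longleftrightarrow> w \<in> V2 - {u}" if "u \<in> U2" for u w
      unfolding dom1 nb2[OF that] using that sub dis by blast
    ultimately have "zero_forcing_number (G1 \<restriction> (verts G1 - U2)) + (card U2 - 1)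
        \<le> zero_forcing_number G1"
      by (intro G1.zero_forcing_number_delete_twins[OF sub(2) ne(2)])
    moreover have "G1 \<restriction> (verts G1 - U2) = H"
      unfolding G1_def H by (auto simp: induce_subgraph_def)
    moreover have "zero_forcing_number G1 + (card U1 - 1) \<le> zero_forcing_number G"
      unfolding G1_def by (rule zero_forcing_number_delete_twins[OF sub(1) ne(1) cl(1) nb1])
    ultimately show ?thesis using assms(3,5) by (simp add: U1_def U2_def)
  qed

  show "zero_forcing_number G \<le> zero_forcing_number H + (k1 - 1) + (k2 - 1)"
  proof (cases "verts H = {}")
    case True
    have k: "k1 \<ge> 2" "k2 \<ge> 2" using assms(8) True by auto
    have VU: "V1 = U1" "V2 = U2" using True vH V sub by blast+
    have "U1 \<subseteq> verts G" "U2 \<subseteq> verts G" using sub V by auto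
    then have fin: "finite U1" "finite U2" by (auto intro: finite_subset)
    obtain u1 u2 where u1: "u1 \<in> U1" and u2: "u2 \<in> U2" using ne by blast
    define T where "T = (U1 - {u1}) \<union> (U2 - {u2})"
    have TC: "T \<subseteq> zf_closure G T" by (rule zf_closure_subset)
    \<comment> \<open>Here \<open>G\<close> is two disjoint cliques, and
      \<open>k1, k2 \<ge> 2\<close> leaves a filled vertex in each to force the omitted one.\<close>
    have "U1 - {u1} \<noteq> {}" "U2 - {u2} \<noteq> {}"
      using k assms(3,5) u1 u2 fin card_Diff_singleton[of u1 U1] card_Diff_singleton[of u2 U2]
      unfolding U1_def[symmetric] U2_def[symmetric] by fastforce+
    then obtain x1 x2 where x: "x1 \<in> U1 - {u1}" "x2 \<in> U2 - {u2}" by blast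
    have "u1 \<in> zf_closure G T"
    proof (rule zf_closure.force[of x1])
      show "x1 \<in> zf_closure G T" using x TC by (auto simp: T_def)
      show "x1 \<rightarrow>\<^bsub>G\<^esub> u1" using nb1 x u1 VU by blast
      show "w \<in> zf_closure G T" if "x1 \<rightarrow>\<^bsub>G\<^esub> w" "w \<noteq> u1" for w
        using that nb1[of x1 w] x VU TC by (auto simp: T_def)
    qed
    moreover have "u2 \<in> zf_closure G T"
    proof (rule zf_closure.force[of x2])
      show "x2 \<in> zf_closure G T" using x TC by (auto simp: T_def)
      show "x2 \<rightarrow>\<^bsub>G\<^esub> u2" using nb2 x u2 VU by blast
      show "w \<in> zf_closure G T" if "x2 \<rightarrow>\<^bsub>G\<^esub> w" "w \<noteq> u2" for w
        using that nb2[of x2 w] x VU TC by (auto simp: T_def)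
    qed
    ultimately have "zero_forcing_set G T"
      using TC V VU by (auto simp: zero_forcing_set_iff T_def)
    then have "zero_forcing_number G \<le> card T" by (rule zero_forcing_number_le)
    also have "\<dots> \<le> card (U1 - {u1}) + card (U2 - {u2})" unfolding T_def by (rule card_Un_le)
    finally show ?thesis using assms(3,5) u1 u2 fin by (simp add: U1_def U2_def)
  next
    case False
    \<comment> \<open>A neighbor across the partition is itself saturated and hence survives the
      deletion, so saturated vertices stay saturated in \<open>H\<close>.\<close>
    have sat1: "\<exists>w\<in>V2 - U2. a \<rightarrow>\<^bsub>G\<^esub> w" if "a \<in> V1 - U1" for a
    proof -
      from that obtain w where w: "w \<in> V2" "a \<rightarrow>\<^bsub>G\<^esub> w" by (auto simp: U1_def unsaturated_def)
      moreover from this have "w \<notin> U2"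
        using that dominates_sym[of a w] by (auto simp: U2_def unsaturated_def)
      ultimately show ?thesis by blast
    qed
    have sat2: "\<exists>w\<in>V1 - U1. a \<rightarrow>\<^bsub>G\<^esub> w" if "a \<in> V2 - U2" for a
    proof -
      from that obtain w where w: "w \<in> V1" "a \<rightarrow>\<^bsub>G\<^esub> w" by (auto simp: U2_def unsaturated_def)
      moreover from this have "w \<notin> U1"
        using that dominates_sym[of a w] by (auto simp: U1_def unsaturated_def)
      ultimately show ?thesis by blast
    qed
    have dis: "V1 \<inter> U2 = {}" "V2 \<inter> U1 = {}" using sub V by blast+
    have "is_clique H (V1 - U1)" "is_clique H (V2 - U2)"
      using cl dis V unfolding is_clique_def vH dom by auto
    moreover have "(V1 - U1) \<union> (V2 - U2) = verts H" using V dis unfolding vH by blast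
    ultimately have cp: "clique_partition H (V1 - U1) (V2 - U2)"
      using V(2) unfolding clique_partition_def by blast
    have us: "unsaturated H (V1 - U1) (V2 - U2) = {}" "unsaturated H (V2 - U2) (V1 - U1) = {}"
      using sat1 sat2 dis unfolding unsaturated_def dom by blast+
    obtain A B S v u where
      AB: "A = V1 - U1 \<and> B = V2 - U2 \<or> A = V2 - U2 \<and> B = V1 - U1"
      and S: "zero_forcing_set H S" "card S = zero_forcing_number H"
        "A \<subseteq> S" "v \<in> A" "u \<in> B" "v \<rightarrow>\<^bsub>H\<^esub> u" "u \<notin> S" "\<And>w. v \<rightarrow>\<^bsub>H\<^esub> w \<Longrightarrow> w \<noteq> u \<Longrightarrow> w \<in> S"
      by (rule H.saturated_crossing_force[OF cp us False]) auto
    from AB show ?thesis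
    proof (elim disjE conjE)
      assume "A = V1 - U1" "B = V2 - U2"
      then show ?thesis
        using zero_forcing_number_le_of_crossing_force[OF assms(2) U1_def U2_def ne H S(1), of v u]
          S assms(3,5) by (simp add: U1_def U2_def)
    next
      \<comment> \<open>The crossing force starts in \<open>V2\<close>; the same bound applies with
        the sides exchanged.\<close>
      assume "A = V2 - U2" "B = V1 - U1"
      moreover have "H = G \<restriction> (verts G - (U2 \<union> U1))" using H by (simp add: Un_commute)
      ultimately show ?thesis
        using zero_forcing_number_le_of_crossing_force
            [OF assms(2)[unfolded clique_partition_commute[of G V1]] U2_def U1_def ne(2,1) _ S(1), of v u]
          S assms(3,5) by (simp add: U1_def U2_def)
    qed
  qed
qed

end
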